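(* Let $\delta\in(0,1/2]$ and $\varepsilon>0$. Consider a UFL instance with general opening costs, let $S'$ be the solution returned by \texttt{LocalSearch-JMS} (with parameter $\varepsilon$), and let $\mathrm{OPT}$ be any feasible solution; write $d'=d(S')$ and $\mathrm{opt}=d(\mathrm{OPT})$. Call $f'\in S'$ and $f^*\in\mathrm{OPT}$ matched if $f'$ $(1-\delta)$-captures $f^*$ and $f^*$ $(1/2)$-captures $f'$; other facilities are lonely. Then $$o(S')+d'\le o(\mathrm{OPT})+\frac{\delta}{1-\delta}d'+\frac{1}{1-\delta}\mathrm{opt}^{M}+4\,\mathrm{opt}^{L}+O\big(\varepsilon(d'+\mathrm{opt})\big).$$
   Context: UFL instance: clients $C$, facilities $F$, metric $dist$, opening costs $o:F\to\mathbb{R}_{\ge0}$; for nonempty $S\subseteq F$, $o(S)=\sum_{f\in S}o(f)$, $d(S)=\sum_{j\in C}\min_{f\in S}dist(j,f)$, $\mathrm{cost}(S)=o(S)+d(S)$. Each client is served by a closest facility of the solution; $C_S(f)$ is the set of clients served by $f$ in $S$. For $\alpha\ge1/2$, $f\in S$ $\alpha$-captures $f''\in S''$ if $|C_S(f)\cap C_{S''}(f'')|>\alpha|C_{S''}(f'')|$. $\mathrm{opt}^M$ (resp. $\mathrm{opt}^L$) is the connection cost in $\mathrm{OPT}$ of the clients served by matched (resp. lonely) facilities of $\mathrm{OPT}$. JMS algorithm: maintain active clients $A$ (initially $C$), open facilities $S$ (initially $\emptyset$), values $\alpha_j$ (initially $0$), and for each inactive client $j$ a facility $S(j)$. Each client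 $j$ offers to each closed facility $f$ the amount $\max\{0,\alpha_j-dist(j,f)\}$ if $j$ is active and $\max\{0,dist(j,S(j))-dist(j,f)\}$ otherwise. Raise all $\alpha_j$ of active clients uniformly until: if $\alpha_j=dist(j,f)$ for an active $j$ and an open $f$, $j$ becomes inactive with $S(j)=f$; if the offers to a closed $f$ reach $o(f)$, open $f$ and set $S(j)=f$ (making $j$ inactive) for every client making a strictly positive offer to $f$. Stop when no client is active and output $S$. \texttt{Extend-JMS}$(X)$: run JMS on the instance in which the opening costs of the facilities in $X$ are set to $0$ (others unchanged) and return its output. \texttt{LocalSearch-JMS} with parameter $\varepsilon$: start with $S'$ = output of JMS; while there is $S''$ with $\mathrm{cost}(S'')<\mathrm{cost}(S')$ (original costs) such that either $|S''\setminus S'|+|S'\setminus S''|\le 1/\varepsilon+1$, or $S''=$\texttt{Extend-JMS}$(S'\setminus\{f\}\cup\{f'\})$ for some $f\in S'$, $f'\notin S'$, set $S'\leftarrow S''$; return $S'$. *)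

theory Defs
  imports "HOL-Analysis.Abstract_Metric_Spaces"
begin

definition ufl_instance ::
  "'a set \<Rightarrow> 'a set \<Rightarrow> ('a \<Rightarrow> 'a \<Rightarrow> real) \<Rightarrow> ('a \<Rightarrow> real) \<Rightarrow> bool" where
  "ufl_instance C F dst oc \<longleftrightarrow>
     finite C \<and> finite F \<and> Metric_space (C \<union> F) dst \<and> (\<forall>f\<in>F. 0 \<le> oc f)"

definition feasible :: "'a set \<Rightarrow> 'a set \<Rightarrow> bool" where
  "feasible F S \<longleftrightarrow> S \<subseteq> F \<and> S \<noteq> {}"

definition opening_cost :: "('a \<Rightarrow> real) \<Rightarrow> 'a set \<Rightarrow> real" where
  "opening_cost oc S = (\<Sum>f\<in>S. oc f)"

definition conn_cost :: "'a set \<Rightarrow> ('a \<Rightarrow> 'a \<Rightarrow> real) \<Rightarrow> 'a set \<Rightarrow> real" where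
  "conn_cost C dst S = (\<Sum>j\<in>C. MIN f\<in>S. dst j f)"

definition cost :: "'a set \<Rightarrow> ('a \<Rightarrow> 'a \<Rightarrow> real) \<Rightarrow> ('a \<Rightarrow> real) \<Rightarrow> 'a set \<Rightarrow> real" where
  "cost C dst oc S = opening_cost oc S + conn_cost C dst S"

text \<open>A solution \<open>S\<close> comes with a map \<open>\<sigma>\<close> sending each client to the closest facility of \<open>S\<close>
  serving it; ties are broken arbitrarily.\<close>

definition serves :: "'a set \<Rightarrow> ('a \<Rightarrow> 'a \<Rightarrow> real) \<Rightarrow> 'a set \<Rightarrow> ('a \<Rightarrow> 'a) \<Rightarrow> bool" where
  "serves C dst S \<sigma> \<longleftrightarrow> (\<forall>j\<in>C. \<sigma> j \<in> S \<and> (\<forall>f\<in>S. dst j (\<sigma> j) \<le> dst j f))"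

definition cluster :: "'a set \<Rightarrow> ('a \<Rightarrow> 'a) \<Rightarrow> 'a \<Rightarrow> 'a set" where
  "cluster C \<sigma> f = {j \<in> C. \<sigma> j = f}"

definition captures ::
  "'a set \<Rightarrow> real \<Rightarrow> ('a \<Rightarrow> 'a) \<Rightarrow> 'a \<Rightarrow> ('a \<Rightarrow> 'a) \<Rightarrow> 'a \<Rightarrow> bool" where
  "captures C \<alpha> \<sigma> f \<sigma>2 f2 \<longleftrightarrow>
     real (card (cluster C \<sigma> f \<inter> cluster C \<sigma>2 f2)) > \<alpha> * real (card (cluster C \<sigma>2 f2))"

definition matched ::
  "'a set \<Rightarrow> real \<Rightarrow> ('a \<Rightarrow> 'a) \<Rightarrow> ('a \<Rightarrow> 'a) \<Rightarrow> 'a \<Rightarrow> 'a \<Rightarrow> bool" where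
  "matched C \<delta> \<sigma> \<sigma>opt f fopt \<longleftrightarrow>
     captures C (1 - \<delta>) \<sigma> f \<sigma>opt fopt \<and> captures C (1/2) \<sigma>opt fopt \<sigma> f"

definition matched_opt ::
  "'a set \<Rightarrow> real \<Rightarrow> 'a set \<Rightarrow> ('a \<Rightarrow> 'a) \<Rightarrow> 'a set \<Rightarrow> ('a \<Rightarrow> 'a) \<Rightarrow> 'a set" where
  "matched_opt C \<delta> S \<sigma> OPT \<sigma>opt = {fopt \<in> OPT. \<exists>f\<in>S. matched C \<delta> \<sigma> \<sigma>opt f fopt}"

definition lonely_opt ::
  "'a set \<Rightarrow> real \<Rightarrow> 'a set \<Rightarrow> ('a \<Rightarrow> 'a) \<Rightarrow> 'a set \<Rightarrow> ('a \<Rightarrow> 'a) \<Rightarrow> 'a set" where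
  "lonely_opt C \<delta> S \<sigma> OPT \<sigma>opt = OPT - matched_opt C \<delta> S \<sigma> OPT \<sigma>opt"

definition conn_cost_served_by ::
  "'a set \<Rightarrow> ('a \<Rightarrow> 'a \<Rightarrow> real) \<Rightarrow> ('a \<Rightarrow> 'a) \<Rightarrow> 'a set \<Rightarrow> real" where
  "conn_cost_served_by C dst \<sigma> G = (\<Sum>j\<in>{j \<in> C. \<sigma> j \<in> G}. dst j (\<sigma> j))"

text \<open>The field \<open>conn\<close> is meaningful for inactive clients only.\<close>

record 'a jms_state =
  active :: "'a set"
  opened :: "'a set"
  budget :: "'a \<Rightarrow> real"
  conn :: "'a \<Rightarrow> 'a"

definition jms_init :: "'a set \<Rightarrow> 'a jms_state" where
  "jms_init C = \<lparr>active = C, opened = {}, budget = (\<lambda>_. 0), conn = (\<lambda>_. undefined)\<rparr>"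

definition offer :: "('a \<Rightarrow> 'a \<Rightarrow> real) \<Rightarrow> 'a jms_state \<Rightarrow> 'a \<Rightarrow> 'a \<Rightarrow> real" where
  "offer dst s j f =
     (if j \<in> active s then max 0 (budget s j - dst j f)
      else max 0 (dst j (conn s j) - dst j f))"

definition can_connect :: "('a \<Rightarrow> 'a \<Rightarrow> real) \<Rightarrow> 'a jms_state \<Rightarrow> 'a \<Rightarrow> 'a \<Rightarrow> bool" where
  "can_connect dst s j f \<longleftrightarrow> j \<in> active s \<and> f \<in> opened s \<and> budget s j = dst j f"

definition can_open ::
  "'a set \<Rightarrow> 'a set \<Rightarrow> ('a \<Rightarrow> 'a \<Rightarrow> real) \<Rightarrow> ('a \<Rightarrow> real) \<Rightarrow> 'a jms_state \<Rightarrow> 'a \<Rightarrow> bool" where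
  "can_open C F dst oc s f \<longleftrightarrow> f \<in> F - opened s \<and> oc f \<le> (\<Sum>j\<in>C. offer dst s j f)"

definition jms_event ::
  "'a set \<Rightarrow> 'a set \<Rightarrow> ('a \<Rightarrow> 'a \<Rightarrow> real) \<Rightarrow> ('a \<Rightarrow> real) \<Rightarrow> 'a jms_state \<Rightarrow> bool" where
  "jms_event C F dst oc s \<longleftrightarrow>
     (\<exists>j f. can_connect dst s j f) \<or> (\<exists>f. can_open C F dst oc s f)"

definition raise_budgets :: "real \<Rightarrow> 'a jms_state \<Rightarrow> 'a jms_state" where
  "raise_budgets t s =
     s\<lparr>budget := (\<lambda>j. if j \<in> active s then budget s j + t else budget s j)\<rparr>"

definition connect_client :: "'a \<Rightarrow> 'a \<Rightarrow> 'a jms_state \<Rightarrow> 'a jms_state" where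
  "connect_client j f s = s\<lparr>active := active s - {j}, conn := (conn s)(j := f)\<rparr>"

definition open_facility ::
  "'a set \<Rightarrow> ('a \<Rightarrow> 'a \<Rightarrow> real) \<Rightarrow> 'a \<Rightarrow> 'a jms_state \<Rightarrow> 'a jms_state" where
  "open_facility C dst f s =
     s\<lparr>active := {j \<in> active s. \<not> offer dst s j f > 0},
       opened := insert f (opened s),
       conn := (\<lambda>j. if j \<in> C \<and> offer dst s j f > 0 then f else conn s j)\<rparr>"

text \<open>Budgets grow exactly until the first event becomes possible; simultaneous events are
  processed one at a time, in an arbitrary order. No step is possible once no client is active.\<close>

inductive jms_step ::
  "'a set \<Rightarrow> 'a set \<Rightarrow> ('a \<Rightarrow> 'a \<Rightarrow> real) \<Rightarrow> ('a \<Rightarrow> real) \<Rightarrow> 'a jms_state \<Rightarrow> 'a jms_state \<Rightarrow> bool"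
  for C F dst oc where
  grow: "\<lbrakk>active s \<noteq> {}; 0 < t;
          \<forall>u. 0 \<le> u \<and> u < t \<longrightarrow> \<not> jms_event C F dst oc (raise_budgets u s);
          jms_event C F dst oc (raise_budgets t s)\<rbrakk>
         \<Longrightarrow> jms_step C F dst oc s (raise_budgets t s)"
| connect: "can_connect dst s j f \<Longrightarrow> jms_step C F dst oc s (connect_client j f s)"
| open_up: "\<lbrakk>active s \<noteq> {}; can_open C F dst oc s f\<rbrakk>
            \<Longrightarrow> jms_step C F dst oc s (open_facility C dst f s)"

definition jms_output ::
  "'a set \<Rightarrow> 'a set \<Rightarrow> ('a \<Rightarrow> 'a \<Rightarrow> real) \<Rightarrow> ('a \<Rightarrow> real) \<Rightarrow> 'a set \<Rightarrow> bool" where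
  "jms_output C F dst oc S \<longleftrightarrow>
     (\<exists>s. (jms_step C F dst oc)\<^sup>*\<^sup>* (jms_init C) s \<and> active s = {} \<and> opened s = S)"

text \<open>An implementation of JMS, for fixed clients, facilities and metric: it maps opening costs
  to the output of some run, i.e. it resolves simultaneous events in some fixed way.\<close>

definition implements_jms ::
  "'a set \<Rightarrow> 'a set \<Rightarrow> ('a \<Rightarrow> 'a \<Rightarrow> real) \<Rightarrow> (('a \<Rightarrow> real) \<Rightarrow> 'a set) \<Rightarrow> bool" where
  "implements_jms C F dst jms \<longleftrightarrow>
     (\<forall>oc. (\<forall>f\<in>F. 0 \<le> oc f) \<longrightarrow> jms_output C F dst oc (jms oc))"

definition extend_jms ::
  "(('a \<Rightarrow> real) \<Rightarrow> 'a set) \<Rightarrow> ('a \<Rightarrow> real) \<Rightarrow> 'a set \<Rightarrow> 'a set" where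
  "extend_jms jms oc X = jms (\<lambda>f. if f \<in> X then 0 else oc f)"

definition ls_improves ::
  "'a set \<Rightarrow> 'a set \<Rightarrow> ('a \<Rightarrow> 'a \<Rightarrow> real) \<Rightarrow> ('a \<Rightarrow> real) \<Rightarrow> (('a \<Rightarrow> real) \<Rightarrow> 'a set) \<Rightarrow> real
    \<Rightarrow> 'a set \<Rightarrow> 'a set \<Rightarrow> bool" where
  "ls_improves C F dst oc jms \<epsilon> S S2 \<longleftrightarrow>
     feasible F S2 \<and> cost C dst oc S2 < cost C dst oc S \<and>
     (real (card (S2 - S) + card (S - S2)) \<le> 1 / \<epsilon> + 1 \<or>
      (\<exists>f\<in>S. \<exists>f2\<in>F - S. S2 = extend_jms jms oc (S - {f} \<union> {f2})))"

definition local_search_jms ::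
  "'a set \<Rightarrow> 'a set \<Rightarrow> ('a \<Rightarrow> 'a \<Rightarrow> real) \<Rightarrow> ('a \<Rightarrow> real) \<Rightarrow> (('a \<Rightarrow> real) \<Rightarrow> 'a set) \<Rightarrow> real
    \<Rightarrow> 'a set \<Rightarrow> bool" where
  "local_search_jms C F dst oc jms \<epsilon> S \<longleftrightarrow>
     (ls_improves C F dst oc jms \<epsilon>)\<^sup>*\<^sup>* (jms oc) S \<and>
     \<not> (\<exists>S2. ls_improves C F dst oc jms \<epsilon> S S2)"

end

theory Submission
  imports Defs
begin

text \<open>
  The final budgets of JMS pay for its output, no client pays more than \<open>oc f + dst j f\<close>, and any
  set of clients pays at most \<open>oc f\<close> plus twice its distance to \<open>f\<close>. Hence Extend-JMS on \<open>X\<close>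
  costs no more than opening \<open>X\<close> together with any set \<open>T\<close>, where the clients assigned to \<open>T\<close>
  pay twice their distance and all other clients connect to \<open>X\<close>.

  Every facility of the optimum gets a partner in the local optimum \<open>S\<close>: the facility it is
  matched with, or the nearest one if it is lonely. For each \<open>f\<close> in \<open>S\<close> consider the move that
  closes \<open>f\<close> and opens all facilities of the optimum with partner \<open>f\<close>; one of them (the matched
  one, if it exists) is swapped in and the others are left to Extend-JMS. Clients of \<open>f\<close> whose
  optimal facility is not opened are rerouted through it to its partner. Over all moves, a client of
  a lonely facility pays \<open>2 opt\<close> for the opening and \<open>2 opt\<close> for the rerouting, which gives the
  factor 4; for a matched facility only a \<open>\<delta>\<close>-fraction of the clients is ever rerouted. This
  argument has no error term, so the constant in the \<open>O\<close>-term is 0.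
\<close>

section \<open>Dual fitting for JMS\<close>

locale ufl_metric =
  fixes C F :: "'a set" and dst :: "'a \<Rightarrow> 'a \<Rightarrow> real"
  assumes finC: "finite C" and finF: "finite F" and metric: "Metric_space (C \<union> F) dst"
begin

lemma dst_nonneg: "0 \<le> dst x y"
  using metric by (rule Metric_space.nonneg)

lemma dst_commute: "dst x y = dst y x"
  using metric by (rule Metric_space.commute)

lemma dst_triangle: "x \<in> C \<union> F \<Longrightarrow> y \<in> C \<union> F \<Longrightarrow> z \<in> C \<union> F \<Longrightarrow> dst x z \<le> dst x y + dst y z"
  using metric by (rule Metric_space.triangle)

text \<open>The last conjunct is a ledger: what connected clients bid beyond their current distance
  has paid for all open facilities. Offers are bounded non-strictly because a paid-up facility may
  wait while simultaneous events are processed.\<close>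

definition jms_invar :: "('a \<Rightarrow> real) \<Rightarrow> 'a jms_state \<Rightarrow> bool" where
  "jms_invar oc s \<longleftrightarrow>
     active s \<subseteq> C \<and> opened s \<subseteq> F \<and>
     (\<exists>t. \<forall>j\<in>active s. budget s j = t) \<and>
     (\<forall>j\<in>C - active s. conn s j \<in> opened s) \<and>
     (\<forall>j\<in>active s. \<forall>f\<in>opened s. budget s j \<le> dst j f) \<and>
     (\<forall>f\<in>F - opened s. (\<Sum>j\<in>C. offer dst s j f) \<le> oc f) \<and>
     opening_cost oc (opened s)
       \<le> (\<Sum>j\<in>C. if j \<in> active s then 0 else budget s j - dst j (conn s j))"

text \<open>\<open>R i j\<close> says that \<open>j\<close> was already inactive when \<open>i\<close> became inactive. In the sum, an
  inactive client \<open>j\<close> offered at least \<open>budget i - dst i f - 2 * dst j f\<close> to \<open>f\<close> at that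
  moment, by the triangle inequality through the facility of \<open>j\<close>.\<close>

definition jms_history :: "('a \<Rightarrow> real) \<Rightarrow> ('a \<Rightarrow> 'a \<Rightarrow> bool) \<Rightarrow> 'a jms_state \<Rightarrow> bool" where
  "jms_history oc R s \<longleftrightarrow>
     (\<forall>i j. R i j \<longrightarrow> \<not> R j i) \<and> (\<forall>i j. R i j \<longrightarrow> i \<notin> active s \<and> j \<notin> active s) \<and>
     (\<forall>i\<in>C - active s. \<forall>f\<in>F. \<forall>N\<subseteq>C.
        (\<Sum>j\<in>N. if R i j then budget s i - dst i f - 2 * dst j f else budget s i - dst j f) \<le> oc f)"

section \<open>Preservation of the invariants during a run\<close>

lemma jms_invar_init:
  assumes "\<forall>f\<in>F. 0 \<le> oc f"
  shows "jms_invar oc (jms_init C)"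
  using assms by (auto simp: jms_invar_def jms_init_def offer_def opening_cost_def dst_nonneg)

lemma jms_invar_grow:
  assumes inv: "jms_invar oc s" and t: "0 < t"
    and quiet: "\<forall>u. 0 \<le> u \<and> u < t \<longrightarrow> \<not> jms_event C F dst oc (raise_budgets u s)"
  shows "jms_invar oc (raise_budgets t s)"
proof -
  have near: "budget s j + t \<le> dst j f" if j: "j \<in> active s" and f: "f \<in> opened s" for j f
  proof (rule ccontr)
    assume "\<not> budget s j + t \<le> dst j f"
    moreover have "budget s j \<le> dst j f"
      using inv j f by (auto simp: jms_invar_def)
    \<comment> \<open>An overshoot past an open facility would have triggered a connect event at
      this smaller raise.\<close>
    moreover have "can_connect dst (raise_budgets (dst j f - budget s j) s) j f"
      using j f by (simp add: can_connect_def raise_budgets_def)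
    ultimately show False
      using quiet[rule_format, of "dst j f - budget s j"] by (auto simp: jms_event_def)
  qed
  have offers: "(\<Sum>j\<in>C. offer dst (raise_budgets t s) j f) \<le> oc f" if f: "f \<in> F - opened s" for f
  proof -
    let ?g = "\<lambda>u. \<Sum>j\<in>C. if j \<in> active s then max 0 (budget s j + u - dst j f)
                   else max 0 (dst j (conn s j) - dst j f)"
    have g: "(\<Sum>j\<in>C. offer dst (raise_budgets u s) j f) = ?g u" for u
      by (intro sum.cong) (auto simp: offer_def raise_budgets_def)
    have cl: "closure {0..<t} = {0..t}"
      using t by simp
    \<comment> \<open>Offers stay strictly below \<open>oc f\<close> before the raise ends; being
      continuous in the raise, they can at most reach it at \<open>t\<close>.\<close>
    have "?g t \<le> oc f"
    proof (rule continuous_le_on_closure[where f = ?g and x = t and a = "oc f"])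
      have "continuous_on A (\<lambda>u. if j \<in> active s then max 0 (budget s j + u - dst j f)
                   else max 0 (dst j (conn s j) - dst j f))" for A j
        by (cases "j \<in> active s") (auto intro!: continuous_intros)
      then show "continuous_on (closure {0..<t}) ?g"
        by (intro continuous_on_sum)
      show "t \<in> closure {0..<t}"
        using t cl by simp
      show "?g u \<le> oc f" if "u \<in> {0..<t}" for u
      proof -
        have "\<not> can_open C F dst oc (raise_budgets u s) f"
          using quiet that by (auto simp: jms_event_def)
        moreover have "f \<in> F - opened (raise_budgets u s)"
          using f by (simp add: raise_budgets_def)
        ultimately have "\<not> oc f \<le> (\<Sum>j\<in>C. offer dst (raise_budgets u s) j f)"
          by (simp add: can_open_def)
        then show ?thesis
          unfolding g by linarith
      qed
    qed
    then show ?thesis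
      unfolding g .
  qed
  obtain t0 where "\<forall>j\<in>active s. budget s j = t0"
    using inv by (auto simp: jms_invar_def)
  then have "\<exists>t0. \<forall>j\<in>active s. budget (raise_budgets t s) j = t0"
    by (intro exI[of _ "t0 + t"]) (simp add: raise_budgets_def)
  moreover have "(\<Sum>j\<in>C. if j \<in> active s then 0 else budget (raise_budgets t s) j - dst j (conn s j))
      = (\<Sum>j\<in>C. if j \<in> active s then 0 else budget s j - dst j (conn s j))"
    by (intro sum.cong) (auto simp: raise_budgets_def)
  moreover have "active (raise_budgets t s) = active s" "opened (raise_budgets t s) = opened s"
    "conn (raise_budgets t s) = conn s"
    by (auto simp: raise_budgets_def)
  moreover have "\<forall>j\<in>active s. \<forall>f\<in>opened s. budget (raise_budgets t s) j \<le> dst j f"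
    using near by (simp add: raise_budgets_def)
  ultimately show ?thesis
    using inv offers unfolding jms_invar_def by (simp cong: if_cong)
qed

lemma jms_invar_connect:
  assumes inv: "jms_invar oc s" and con: "can_connect dst s j f"
  shows "jms_invar oc (connect_client j f s)"
proof -
  let ?s = "connect_client j f s"
  have j: "j \<in> active s" "f \<in> opened s" "budget s j = dst j f"
    using con by (auto simp: can_connect_def)
  have fields: "active ?s = active s - {j}" "opened ?s = opened s" "budget ?s = budget s"
    "conn ?s = (conn s)(j := f)"
    by (auto simp: connect_client_def)
  \<comment> \<open>At a connect event \<open>budget s j = dst j f\<close>, so the active and
    inactive formulas for offers agree and the new surplus is zero.\<close>
  have "offer dst ?s i g = offer dst s i g" for i g
    using j by (auto simp: offer_def fields)
  moreover have "(\<Sum>i\<in>C. if i \<in> active ?s then 0 else budget ?s i - dst i (conn ?s i))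
      = (\<Sum>i\<in>C. if i \<in> active s then 0 else budget s i - dst i (conn s i))"
    using j by (intro sum.cong) (auto simp: fields)
  ultimately show ?thesis
    using inv j unfolding jms_invar_def by (auto simp: fields)
qed

lemma jms_invar_open:
  assumes inv: "jms_invar oc s" and op: "can_open C F dst oc s f"
  shows "jms_invar oc (open_facility C dst f s)"
proof -
  let ?s = "open_facility C dst f s"
  have f: "f \<in> F" "f \<notin> opened s" "oc f \<le> (\<Sum>j\<in>C. offer dst s j f)"
    using op by (auto simp: can_open_def)
  have fields: "active ?s = {j \<in> active s. \<not> offer dst s j f > 0}" "opened ?s = insert f (opened s)"
    "budget ?s = budget s" "conn ?s = (\<lambda>j. if j \<in> C \<and> offer dst s j f > 0 then f else conn s j)"
    by (auto simp: open_facility_def)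
  have sub: "active s \<subseteq> C" "opened s \<subseteq> F"
    using inv by (auto simp: jms_invar_def)
  \<comment> \<open>Switching to \<open>f\<close> lowers the amount from which a client's offers are
    computed, so no offer grows.\<close>
  have "offer dst ?s j g \<le> offer dst s j g" if "j \<in> C" for j g
    using that unfolding offer_def[of dst ?s] fields
    by (auto simp: offer_def split: if_splits)
  then have "(\<Sum>j\<in>C. offer dst ?s j g) \<le> (\<Sum>j\<in>C. offer dst s j g)" for g
    by (rule sum_mono)
  then have offers: "(\<Sum>j\<in>C. offer dst ?s j g) \<le> oc g" if "g \<in> F - opened ?s" for g
  proof -
    have "(\<Sum>j\<in>C. offer dst s j g) \<le> oc g"
      using inv that by (simp add: jms_invar_def fields)
    then show ?thesis
      using \<open>(\<Sum>j\<in>C. offer dst ?s j g) \<le> (\<Sum>j\<in>C. offer dst s j g)\<close> by linarith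
  qed
  \<comment> \<open>Each client's surplus grows by exactly its offer to \<open>f\<close>, whether it
    was active or is rerouted, and these offers cover \<open>oc f\<close>.\<close>
  have "(\<Sum>j\<in>C. if j \<in> active ?s then 0 else budget ?s j - dst j (conn ?s j))
      = (\<Sum>j\<in>C. (if j \<in> active s then 0 else budget s j - dst j (conn s j)) + offer dst s j f)"
    by (intro sum.cong refl) (auto simp: fields offer_def max_def)
  then have "opening_cost oc (opened ?s)
      \<le> (\<Sum>j\<in>C. if j \<in> active ?s then 0 else budget ?s j - dst j (conn ?s j))"
    using inv f finite_subset[OF sub(2) finF]
    by (simp add: sum.distrib jms_invar_def fields opening_cost_def)
  moreover have "\<exists>t. \<forall>j\<in>active ?s. budget ?s j = t"
    using inv by (auto simp: jms_invar_def fields)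
  moreover have "\<forall>j\<in>C - active ?s. conn ?s j \<in> opened ?s"
    using inv by (auto simp: jms_invar_def fields)
  moreover have "\<forall>j\<in>active ?s. \<forall>g\<in>opened ?s. budget ?s j \<le> dst j g"
    using inv by (auto simp: jms_invar_def fields offer_def)
  moreover have "active ?s \<subseteq> C" "opened ?s \<subseteq> F"
    using sub f by (auto simp: fields)
  ultimately show ?thesis
    using offers unfolding jms_invar_def by blast
qed

lemma jms_invar_step:
  assumes "jms_step C F dst oc s s'" "jms_invar oc s"
  shows "jms_invar oc s'"
  using assms by cases (auto intro: jms_invar_grow jms_invar_connect jms_invar_open)

text \<open>If \<open>f\<close> is open, every summand is nonpositive. If \<open>f\<close> is
  closed, every summand is at most the client's current offer, and the invariant caps the sum of
  offers.\<close>

lemma active_client_contribution: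
  assumes inv: "jms_invar oc s" and oc: "\<forall>f\<in>F. 0 \<le> oc f"
    and i: "i \<in> active s" and f: "f \<in> F" and N: "N \<subseteq> C"
  shows "(\<Sum>j\<in>N. if j \<notin> active s then budget s i - dst i f - 2 * dst j f
                  else budget s i - dst j f) \<le> oc f"
proof -
  have sub: "active s \<subseteq> C" "opened s \<subseteq> F"
    using inv by (auto simp: jms_invar_def)
  have same: "budget s j = budget s i" if "j \<in> active s" for j
    using inv i that by (auto simp: jms_invar_def)
  show ?thesis
  proof (cases "f \<in> opened s")
    case True
    then have "budget s j \<le> dst j f" if "j \<in> active s" for j
      using inv that by (auto simp: jms_invar_def)
    then have "(\<Sum>j\<in>N. if j \<notin> active s then budget s i - dst i f - 2 * dst j f
                  else budget s i - dst j f) \<le> 0"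
      using i same dst_nonneg
      by (intro sum_nonpos) (smt (verit, best))
    then show ?thesis
      using oc f by force
  next
    case False
    have "(\<Sum>j\<in>N. if j \<notin> active s then budget s i - dst i f - 2 * dst j f
                  else budget s i - dst j f) \<le> (\<Sum>j\<in>N. offer dst s j f)"
    proof (rule sum_mono)
      fix j assume "j \<in> N"
      then have j: "j \<in> C" using N by auto
      show "(if j \<notin> active s then budget s i - dst i f - 2 * dst j f
                  else budget s i - dst j f) \<le> offer dst s j f"
      proof (cases "j \<in> active s")
        case True
        then show ?thesis
          using same[OF True] by (simp add: offer_def)
      next
        case False
        let ?h = "conn s j"
        have h: "?h \<in> opened s"
          using inv j False by (auto simp: jms_invar_def)
        then have "budget s i \<le> dst i ?h"
          using inv i by (auto simp: jms_invar_def)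
        moreover have "dst i ?h \<le> dst i f + dst f ?h"
          using dst_triangle i f h sub by blast
        moreover have "dst f ?h \<le> dst f j + dst j ?h"
          using dst_triangle j f h sub by blast
        ultimately show ?thesis
          using False dst_commute[of f j] by (simp add: offer_def)
      qed
    qed
    also have "\<dots> \<le> (\<Sum>j\<in>C. offer dst s j f)"
      by (intro sum_mono2 finC N) (auto simp: offer_def)
    also have "\<dots> \<le> oc f"
      using inv f False by (auto simp: jms_invar_def)
    finally show ?thesis .
  qed
qed

text \<open>Newly inactive clients are related to those inactive before, not to one another, which
  keeps asymmetry under simultaneous deactivation. Their budgets freeze, so the bound for active
  clients becomes permanent.\<close>

lemma jms_history_deactivate:
  assumes inv: "jms_invar oc s" and oc: "\<forall>f\<in>F. 0 \<le> oc f" and hist: "jms_history oc R s"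
    and act: "active s' \<subseteq> active s"
    and bud: "\<forall>i\<in>C - active s'. budget s' i = budget s i"
  shows "\<exists>R'. jms_history oc R' s'"
proof
  let ?R = "\<lambda>i j. R i j \<or> (i \<in> active s - active s' \<and> j \<notin> active s)"
  have asym: "\<not> R j i" if "R i j" for i j
    using hist that by (auto simp: jms_history_def)
  have inact: "i \<notin> active s \<and> j \<notin> active s" if "R i j" for i j
    using hist that by (auto simp: jms_history_def)
  have "(\<Sum>j\<in>N. if ?R i j then budget s' i - dst i f - 2 * dst j f else budget s' i - dst j f) \<le> oc f"
    if i: "i \<in> C - active s'" and f: "f \<in> F" and N: "N \<subseteq> C" for i f N
  proof (cases "i \<in> active s")
    case True
    then have "?R i j \<longleftrightarrow> j \<notin> active s" for j
      using i inact by auto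
    moreover have "budget s' i = budget s i" using bud i by auto
    ultimately show ?thesis
      using active_client_contribution[OF inv oc True f N] by (simp cong: if_cong)
  next
    case False
    then have "?R i j \<longleftrightarrow> R i j" for j by auto
    moreover have "budget s' i = budget s i" using bud i by auto
    ultimately show ?thesis
      using hist i f N False by (simp add: jms_history_def cong: if_cong)
  qed
  then show "jms_history oc ?R s'"
    unfolding jms_history_def using asym inact act by blast
qed

lemma jms_history_step:
  assumes "jms_step C F dst oc s s'" "jms_invar oc s" "\<forall>f\<in>F. 0 \<le> oc f" "jms_history oc R s"
  shows "\<exists>R'. jms_history oc R' s'"
proof (rule jms_history_deactivate[OF assms(2-4)])
  show "active s' \<subseteq> active s"
    using assms(1) by cases (auto simp: raise_budgets_def connect_client_def open_facility_def)
  show "\<forall>i\<in>C - active s'. budget s' i = budget s i"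
    using assms(1) by cases (auto simp: raise_budgets_def connect_client_def open_facility_def)
qed

lemma jms_reachable:
  assumes "(jms_step C F dst oc)\<^sup>*\<^sup>* (jms_init C) s" and oc: "\<forall>f\<in>F. 0 \<le> oc f"
  shows "jms_invar oc s \<and> (\<exists>R. jms_history oc R s)"
  using assms(1)
proof (induction rule: rtranclp_induct)
  case base
  have "jms_history oc (\<lambda>_ _. False) (jms_init C)"
    by (auto simp: jms_history_def jms_init_def)
  then show ?case
    using jms_invar_init[OF oc] by blast
next
  case (step s s')
  then show ?case
    using jms_invar_step jms_history_step oc by blast
qed

section \<open>Bounds on the final budgets\<close>

text \<open>Averaging the contribution inequalities over \<open>i \<in> N\<close>: by asymmetry of \<open>R\<close>, each pair of
  clients pays the detour \<open>dst i f + dst j f\<close> at most once.\<close>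

lemma dual_fitting_average:
  fixes \<alpha> d :: "'a \<Rightarrow> real"
  assumes fin: "finite N" and c: "0 \<le> c" and d: "\<And>j. 0 \<le> d j"
    and asym: "\<And>i j. R i j \<Longrightarrow> \<not> R j i"
    and bound: "\<And>i. i \<in> N \<Longrightarrow> (\<Sum>j\<in>N. if R i j then \<alpha> i - d i - 2 * d j else \<alpha> i - d j) \<le> c"
  shows "sum \<alpha> N \<le> c + 2 * sum d N"
proof (cases "N = {}")
  case False
  define k where "k = real (card N)"
  have k: "0 < k"
    using False fin by (simp add: k_def card_gt_0_iff)
  let ?e = "\<lambda>i j. if R i j then d i + d j else 0"
  define P where "P = (\<Sum>i\<in>N. \<Sum>j\<in>N. ?e i j)"
  have "P = (\<Sum>i\<in>N. \<Sum>j\<in>N. ?e j i)"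
    unfolding P_def by (rule sum.swap)
  then have "2 * P = (\<Sum>i\<in>N. \<Sum>j\<in>N. ?e i j + ?e j i)"
    by (simp add: P_def sum.distrib)
  also have "\<dots> \<le> (\<Sum>i\<in>N. \<Sum>j\<in>N. d i + d j)"
    using asym by (intro sum_mono) (auto simp: d add_nonneg_nonneg)
  also have "\<dots> = 2 * (k * sum d N)"
    by (simp add: sum.distrib k_def sum_distrib_left)
  finally have P: "P \<le> k * sum d N" by simp
  have "(\<Sum>i\<in>N. \<Sum>j\<in>N. \<alpha> i - d j - ?e i j) \<le> (\<Sum>i\<in>N. c)"
  proof (rule sum_mono)
    fix i assume "i \<in> N"
    moreover have "(\<Sum>j\<in>N. \<alpha> i - d j - ?e i j)
        = (\<Sum>j\<in>N. if R i j then \<alpha> i - d i - 2 * d j else \<alpha> i - d j)"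
      by (intro sum.cong) auto
    ultimately show "(\<Sum>j\<in>N. \<alpha> i - d j - ?e i j) \<le> c"
      using bound by simp
  qed
  moreover have "(\<Sum>i\<in>N. \<Sum>j\<in>N. \<alpha> i - d j - ?e i j) = k * sum \<alpha> N - k * sum d N - P"
    by (simp add: sum_subtractf P_def k_def sum_distrib_left)
  ultimately have "k * sum \<alpha> N \<le> k * (c + 2 * sum d N)"
    using P by (simp add: k_def algebra_simps)
  then show ?thesis
    using k by simp
qed (simp add: c)

lemma jms_output_dual:
  assumes out: "jms_output C F dst oc S" and oc: "\<forall>f\<in>F. 0 \<le> oc f"
  obtains \<alpha> where "S \<subseteq> F" "C \<noteq> {} \<Longrightarrow> S \<noteq> {}"
    "cost C dst oc S \<le> sum \<alpha> C"
    "\<And>j f. j \<in> C \<Longrightarrow> f \<in> F \<Longrightarrow> \<alpha> j \<le> oc f + dst j f"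
    "\<And>f N. f \<in> F \<Longrightarrow> N \<subseteq> C \<Longrightarrow> sum \<alpha> N \<le> oc f + 2 * (\<Sum>j\<in>N. dst j f)"
proof -
  obtain s where s: "(jms_step C F dst oc)\<^sup>*\<^sup>* (jms_init C) s" "active s = {}" "opened s = S"
    using out by (auto simp: jms_output_def)
  obtain R where inv: "jms_invar oc s" and hist: "jms_history oc R s"
    using jms_reachable[OF s(1) oc] by blast
  have conn: "conn s j \<in> S" if "j \<in> C" for j
    using inv s that by (auto simp: jms_invar_def)
  have S: "S \<subseteq> F"
    using inv s by (auto simp: jms_invar_def)
  then have "finite S"
    using finF finite_subset by blast
  then have "conn_cost C dst S \<le> (\<Sum>j\<in>C. dst j (conn s j))"
    unfolding conn_cost_def using conn by (intro sum_mono) auto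
  \<comment> \<open>With no client active, the ledger covers all of \<open>C\<close>; the connection
    distances cancel and only the budgets remain.\<close>
  then have cost: "cost C dst oc S \<le> sum (budget s) C"
    using inv s by (simp add: jms_invar_def cost_def sum_subtractf)
  have asym: "\<not> R j i" if "R i j" for i j
    using hist that by (auto simp: jms_history_def)
  have bound: "(\<Sum>j\<in>N. if R i j then budget s i - dst i f - 2 * dst j f else budget s i - dst j f) \<le> oc f"
    if "i \<in> C" "f \<in> F" "N \<subseteq> C" for i f N
    using hist s that by (simp add: jms_history_def)
  show ?thesis
  proof
    show "S \<subseteq> F" by fact
    show "S \<noteq> {}" if "C \<noteq> {}" using that conn by auto
    show "cost C dst oc S \<le> sum (budget s) C" by fact
    show "budget s j \<le> oc f + dst j f" if "j \<in> C" "f \<in> F" for j f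
    proof -
      \<comment> \<open>Irreflexivity selects the plain summand \<open>budget s j - dst j f\<close>
        in the singleton sum.\<close>
      have "\<not> R j j"
        using asym by blast
      then show ?thesis
        using bound[of j f "{j}"] that by simp
    qed
    show "sum (budget s) N \<le> oc f + 2 * (\<Sum>j\<in>N. dst j f)" if f: "f \<in> F" and N: "N \<subseteq> C" for f N
    proof (rule dual_fitting_average[where R = R])
      show "finite N" using N finC finite_subset by blast
      show "0 \<le> oc f" using oc f by blast
      show "(\<Sum>j\<in>N. if R i j then budget s i - dst i f - 2 * dst j f else budget s i - dst j f) \<le> oc f"
        if "i \<in> N" for i
        using bound f N that by blast
    qed (use asym dst_nonneg in auto)
  qed
qed

end

section \<open>The cost of Extend-JMS\<close>

context ufl_metric
begin

lemma conn_cost_serves: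
  assumes "serves C dst S \<sigma>" "finite S"
  shows "conn_cost C dst S = (\<Sum>j\<in>C. dst j (\<sigma> j))"
  unfolding conn_cost_def
proof (rule sum.cong)
  fix j assume "j \<in> C"
  then show "(MIN f\<in>S. dst j f) = dst j (\<sigma> j)"
    using assms by (intro Min_eqI) (auto simp: serves_def)
qed simp

lemma conn_cost_le:
  assumes "finite S" "\<And>j. j \<in> C \<Longrightarrow> \<exists>f\<in>S. dst j f \<le> g j"
  shows "conn_cost C dst S \<le> sum g C"
  unfolding conn_cost_def
proof (rule sum_mono)
  fix j assume "j \<in> C"
  then obtain f where "f \<in> S" "dst j f \<le> g j"
    using assms by blast
  moreover have "(MIN f\<in>S. dst j f) \<le> dst j f"
    using assms(1) \<open>f \<in> S\<close> by (intro Min_le) auto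
  ultimately show "(MIN f\<in>S. dst j f) \<le> g j"
    by linarith
qed

lemma opening_cost_mono:
  assumes "\<forall>f\<in>F. 0 \<le> oc f" "A \<subseteq> B" "B \<subseteq> F"
  shows "opening_cost oc A \<le> opening_cost oc B"
  unfolding opening_cost_def
  using assms finite_subset[OF assms(3) finF] by (intro sum_mono2) auto

text \<open>\<open>g\<close> prices each client. A client assigned to \<open>T\<close> is covered by
  the group bound of its facility, any other by the single-client bound at a facility of
  \<open>X\<close>, which is free in the modified instance.\<close>

lemma extend_jms_bound:
  assumes oc: "\<forall>f\<in>F. 0 \<le> oc f" and impl: "implements_jms C F dst jms" and C: "C \<noteq> {}"
    and X: "X \<subseteq> F" and T: "T \<subseteq> F"
    and near: "\<And>j. j \<in> C \<Longrightarrow> \<sigma> j \<notin> T \<Longrightarrow> \<exists>f\<in>X. dst j f \<le> g j"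
    and far: "\<And>j. j \<in> C \<Longrightarrow> \<sigma> j \<in> T \<Longrightarrow> 2 * dst j (\<sigma> j) \<le> g j"
  shows "feasible F (extend_jms jms oc X)"
    and "cost C dst oc (extend_jms jms oc X) \<le> opening_cost oc X + opening_cost oc T + sum g C"
proof -
  let ?S = "extend_jms jms oc X"
  let ?oc = "\<lambda>f. if f \<in> X then 0 else oc f"
  have oc': "\<forall>f\<in>F. 0 \<le> ?oc f"
    using oc by simp
  then have out: "jms_output C F dst ?oc ?S"
    using impl by (simp add: implements_jms_def extend_jms_def)
  obtain \<alpha> where S: "?S \<subseteq> F" "C \<noteq> {} \<Longrightarrow> ?S \<noteq> {}"
    and cost: "cost C dst ?oc ?S \<le> sum \<alpha> C"
    and single: "\<And>j f. j \<in> C \<Longrightarrow> f \<in> F \<Longrightarrow> \<alpha> j \<le> ?oc f + dst j f"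
    and group: "\<And>f N. f \<in> F \<Longrightarrow> N \<subseteq> C \<Longrightarrow> sum \<alpha> N \<le> ?oc f + 2 * (\<Sum>j\<in>N. dst j f)"
    by (fact jms_output_dual[OF out oc'])
  show "feasible F ?S"
    using S C by (simp add: feasible_def)
  have fin: "finite ?S" "finite T"
    using S T finF finite_subset by blast+
  \<comment> \<open>Restoring the original costs adds only the facilities of \<open>X\<close> that
    JMS opened.\<close>
  have "opening_cost oc ?S = opening_cost ?oc ?S + opening_cost oc (?S \<inter> X)"
  proof -
    have "opening_cost oc ?S = (\<Sum>f\<in>?S. ?oc f + (if f \<in> X then oc f else 0))"
      unfolding opening_cost_def by (intro sum.cong) auto
    then show ?thesis
      using fin by (simp add: opening_cost_def sum.distrib sum.inter_restrict)
  qed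
  also have "\<dots> \<le> opening_cost ?oc ?S + opening_cost oc X"
    using opening_cost_mono[OF oc _ X] by simp
  finally have "cost C dst oc ?S \<le> opening_cost oc X + sum \<alpha> C"
    using cost by (simp add: cost_def)
  moreover have "sum \<alpha> C \<le> opening_cost oc T + sum g C"
  proof -
    let ?A = "{j \<in> C. \<sigma> j \<in> T}"
    have "sum \<alpha> ?A = (\<Sum>f\<in>T. \<Sum>j\<in>{j \<in> ?A. \<sigma> j = f}. \<alpha> j)"
      using finC fin by (intro sum.group[symmetric]) auto
    also have "\<dots> \<le> (\<Sum>f\<in>T. oc f + (\<Sum>j\<in>{j \<in> ?A. \<sigma> j = f}. g j))"
    proof (rule sum_mono)
      fix f assume f: "f \<in> T"
      let ?N = "{j \<in> ?A. \<sigma> j = f}"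
      have "sum \<alpha> ?N \<le> ?oc f + 2 * (\<Sum>j\<in>?N. dst j f)"
        using f T by (intro group) auto
      also have "\<dots> \<le> oc f + 2 * (\<Sum>j\<in>?N. dst j f)"
        using oc f T by auto
      also have "2 * (\<Sum>j\<in>?N. dst j f) \<le> sum g ?N"
        unfolding sum_distrib_left using far by (intro sum_mono) auto
      finally show "sum \<alpha> ?N \<le> oc f + sum g ?N" by simp
    qed
    also have "\<dots> = opening_cost oc T + (\<Sum>f\<in>T. \<Sum>j\<in>{j \<in> ?A. \<sigma> j = f}. g j)"
      by (simp add: sum.distrib opening_cost_def)
    also have "(\<Sum>f\<in>T. \<Sum>j\<in>{j \<in> ?A. \<sigma> j = f}. g j) = sum g ?A"
      using finC fin by (intro sum.group) auto
    finally have "sum \<alpha> ?A \<le> opening_cost oc T + sum g ?A" .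
    moreover have "sum \<alpha> (C - ?A) \<le> sum g (C - ?A)"
    proof (rule sum_mono)
      fix j assume "j \<in> C - ?A"
      then have j: "j \<in> C" "\<sigma> j \<notin> T" by auto
      obtain f where f: "f \<in> X" "dst j f \<le> g j"
        using near[OF j] by blast
      have "\<alpha> j \<le> ?oc f + dst j f"
        using f X by (intro single[OF j(1)]) auto
      then show "\<alpha> j \<le> g j"
        using f by simp
    qed
    moreover have "sum h C = sum h ?A + sum h (C - ?A)" for h :: "'a \<Rightarrow> real"
      using finC by (subst sum.subset_diff[of ?A C]) auto
    ultimately show ?thesis
      by (smt (verit))
  qed
  ultimately show "cost C dst oc ?S \<le> opening_cost oc X + opening_cost oc T + sum g C"
    by linarith
qed

end

section \<open>Local optima\<close>

locale jms_local_optimum = ufl_metric C F dst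
  for C F :: "'a set" and dst :: "'a \<Rightarrow> 'a \<Rightarrow> real" +
  fixes oc :: "'a \<Rightarrow> real" and jms :: "('a \<Rightarrow> real) \<Rightarrow> 'a set" and \<delta> \<epsilon> :: real
    and S OPT :: "'a set" and \<sigma> \<sigma>opt :: "'a \<Rightarrow> 'a"
  assumes oc: "\<forall>f\<in>F. 0 \<le> oc f" and impl: "implements_jms C F dst jms" and C: "C \<noteq> {}"
    and \<delta>: "0 < \<delta>" "\<delta> \<le> 1/2" and \<epsilon>: "0 < \<epsilon>"
    and local_opt: "\<And>S2. \<not> ls_improves C F dst oc jms \<epsilon> S S2"
    and SF: "S \<subseteq> F" and OPT: "feasible F OPT"
    and serves: "serves C dst S \<sigma>" and serves_opt: "serves C dst OPT \<sigma>opt"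
begin

abbreviation "M \<equiv> matched_opt C \<delta> S \<sigma> OPT \<sigma>opt"

lemma finite_S: "finite S" and finite_OPT: "finite OPT" and OPT_F: "OPT \<subseteq> F"
  using SF OPT finF finite_subset by (auto simp: feasible_def)

lemma \<sigma>: "j \<in> C \<Longrightarrow> \<sigma> j \<in> S" "j \<in> C \<Longrightarrow> f \<in> S \<Longrightarrow> dst j (\<sigma> j) \<le> dst j f"
  using serves by (auto simp: serves_def)

lemma \<sigma>opt: "j \<in> C \<Longrightarrow> \<sigma>opt j \<in> OPT"
  using serves_opt by (auto simp: serves_def)

lemma S_nonempty: "S \<noteq> {}"
  using C \<sigma> by auto

text \<open>Adding or dropping one facility lies in the neighbourhood for every positive \<epsilon>,
  which keeps \<epsilon> out of the final bound.\<close>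

lemma cost_le_if_symdiff_le_1:
  assumes "feasible F S2" "card (S2 - S) + card (S - S2) \<le> 1"
  shows "cost C dst oc S \<le> cost C dst oc S2"
proof -
  have "real (card (S2 - S) + card (S - S2)) \<le> 1"
    using assms(2) by linarith
  also have "1 \<le> 1 / \<epsilon> + 1"
    using \<epsilon> by simp
  finally show ?thesis
    using local_opt[of S2] assms(1) by (auto simp: ls_improves_def)
qed

lemma cost_le_extend_jms:
  assumes "f \<in> S" "f2 \<in> F - S" "feasible F (extend_jms jms oc (S - {f} \<union> {f2}))"
  shows "cost C dst oc S \<le> cost C dst oc (extend_jms jms oc (S - {f} \<union> {f2}))"
  using local_opt[of "extend_jms jms oc (S - {f} \<union> {f2})"] assms
  by (auto simp: ls_improves_def)

lemma cost_S: "cost C dst oc S = opening_cost oc S + (\<Sum>j\<in>C. dst j (\<sigma> j))"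
  using conn_cost_serves[OF serves finite_S] by (simp add: cost_def)

section \<open>Partners and charges\<close>

text \<open>A facility of the optimum is opened in the move that closes its partner.\<close>

definition partner :: "'a \<Rightarrow> 'a" where
  "partner f = (if f \<in> M then SOME h. h \<in> S \<and> matched C \<delta> \<sigma> \<sigma>opt h f
                else arg_min_on (dst f) S)"

lemma partner_matched: "f \<in> M \<Longrightarrow> partner f \<in> S \<and> matched C \<delta> \<sigma> \<sigma>opt (partner f) f"
  unfolding partner_def
  using someI_ex[of "\<lambda>h. h \<in> S \<and> matched C \<delta> \<sigma> \<sigma>opt h f"] by (auto simp: matched_opt_def)

lemma partner_in_S: "partner f \<in> S"
  using partner_matched arg_min_if_finite(1)[OF finite_S S_nonempty]
  by (cases "f \<in> M") (auto simp: partner_def)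

lemma partner_nearest: "f \<notin> M \<Longrightarrow> h \<in> S \<Longrightarrow> dst f (partner f) \<le> dst f h"
  using arg_min_least[OF finite_S S_nonempty] by (simp add: partner_def)

text \<open>Each would hold more than half of the partner's cluster, and their own clusters are
  disjoint. Hence at most one matched facility has to be swapped in per move.\<close>

lemma partner_inj_on_matched:
  assumes "f \<in> M" "g \<in> M" "partner f = partner g"
  shows "f = g"
proof (rule ccontr)
  assume ne: "f \<noteq> g"
  let ?D = "cluster C \<sigma> (partner f)"
  let ?f = "cluster C \<sigma>opt f \<inter> ?D" and ?g = "cluster C \<sigma>opt g \<inter> ?D"
  have "real (card ?f) > 1/2 * card ?D" "real (card ?g) > 1/2 * card ?D"
    using partner_matched[OF assms(1)] partner_matched[OF assms(2)] assms(3)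
    by (auto simp: matched_def captures_def)
  moreover have "card (?f \<union> ?g) = card ?f + card ?g"
    using ne finC by (intro card_Un_disjoint) (auto simp: cluster_def)
  moreover have "card (?f \<union> ?g) \<le> card ?D"
    using finC by (intro card_mono) (auto simp: cluster_def)
  ultimately show False
    by linarith
qed

text \<open>Price for \<open>j\<close> of the move closing the partner of
  \<open>\<sigma>opt j\<close>. A lonely facility may be left to Extend-JMS, hence the factor 2; a
  matched one is open, and \<open>j\<close> moves there if \<open>\<sigma> j\<close> closes and
  stays at no charge otherwise.\<close>

definition open_charge :: "'a \<Rightarrow> real" where
  "open_charge j =
     (if \<sigma>opt j \<notin> M then 2 * dst j (\<sigma>opt j) - dst j (\<sigma> j)
      else if partner (\<sigma>opt j) = \<sigma> j then dst j (\<sigma>opt j) - dst j (\<sigma> j) else 0)"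

text \<open>Extra price of the move closing \<open>\<sigma> j\<close>, for rerouting through
  \<open>\<sigma>opt j\<close> to its partner. In the lonely case the partner is no farther from
  \<open>\<sigma>opt j\<close> than \<open>\<sigma> j\<close> is, so the increase collapses to twice
  the optimal distance. The price is zero if the same move opens the matched
  \<open>\<sigma>opt j\<close>.\<close>

definition close_charge :: "'a \<Rightarrow> real" where
  "close_charge j =
     (if \<sigma>opt j \<notin> M then 2 * dst j (\<sigma>opt j)
      else if partner (\<sigma>opt j) = \<sigma> j then 0
      else dst j (\<sigma>opt j) + dst (\<sigma>opt j) (partner (\<sigma>opt j)) - dst j (\<sigma> j))"

definition charge :: "'a \<Rightarrow> 'a \<Rightarrow> real" where
  "charge f j = (if partner (\<sigma>opt j) = f then open_charge j else 0)
              + (if \<sigma> j = f then close_charge j else 0)"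

definition opt_of :: "'a \<Rightarrow> 'a set" where
  "opt_of f = {g \<in> OPT. partner g = f}"

section \<open>Inequalities from single moves\<close>

lemma opt_of_subset: "opt_of f \<subseteq> OPT"
  by (auto simp: opt_of_def)

lemma dst_partner_le:
  assumes "j \<in> C"
  shows "dst j (partner (\<sigma>opt j)) \<le> dst j (\<sigma>opt j) + dst (\<sigma>opt j) (partner (\<sigma>opt j))"
  using dst_triangle[of j "\<sigma>opt j" "partner (\<sigma>opt j)"] assms \<sigma>opt OPT_F partner_in_S SF by blast

lemma close_charge_nonneg:
  assumes "j \<in> C"
  shows "0 \<le> close_charge j"
  using \<sigma>(2)[OF assms partner_in_S[of "\<sigma>opt j"]] dst_partner_le[OF assms] dst_nonneg[of j "\<sigma>opt j"]
  by (simp add: close_charge_def)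

text \<open>Local optimality against adding \<open>f\<close>, where only those clients of
  \<open>f\<close> that gain switch; an \<open>f\<close> already in \<open>S\<close> attracts
  none.\<close>

lemma addition_bound:
  assumes f: "f \<in> OPT"
  shows "0 \<le> (if f \<in> S then 0 else oc f)
           + (\<Sum>j\<in>cluster C \<sigma>opt f. min 0 (dst j (\<sigma>opt j) - dst j (\<sigma> j)))"
proof (cases "f \<in> S")
  case True
  then have "min 0 (dst j (\<sigma>opt j) - dst j (\<sigma> j)) = 0" if "j \<in> cluster C \<sigma>opt f" for j
    using that \<sigma>(2) by (fastforce simp: cluster_def)
  then show ?thesis
    using True by simp
next
  case False
  let ?g = "\<lambda>j. dst j (\<sigma> j) + (if \<sigma>opt j = f then min 0 (dst j (\<sigma>opt j) - dst j (\<sigma> j)) else 0)"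
  have "insert f S - S = {f}" "S - insert f S = {}"
    using False by auto
  then have "cost C dst oc S \<le> cost C dst oc (insert f S)"
    using f OPT_F SF by (intro cost_le_if_symdiff_le_1) (auto simp: feasible_def)
  also have "\<dots> = oc f + opening_cost oc S + conn_cost C dst (insert f S)"
    using False finite_S by (simp add: cost_def opening_cost_def)
  also have "conn_cost C dst (insert f S) \<le> sum ?g C"
  proof (rule conn_cost_le)
    fix j assume j: "j \<in> C"
    show "\<exists>h\<in>insert f S. dst j h \<le> ?g j"
    proof (cases "\<sigma>opt j = f \<and> dst j f \<le> dst j (\<sigma> j)")
      case True
      then show ?thesis by auto
    next
      case False
      then have "dst j (\<sigma> j) \<le> ?g j" by auto
      then show ?thesis using \<sigma>(1)[OF j] by blast
    qed
  qed (use finite_S in simp)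
  also have "sum ?g C = (\<Sum>j\<in>C. dst j (\<sigma> j))
      + (\<Sum>j\<in>cluster C \<sigma>opt f. min 0 (dst j (\<sigma>opt j) - dst j (\<sigma> j)))"
    using finC by (simp only: sum.distrib cluster_def sum.inter_filter)
  finally show ?thesis
    using False by (simp add: cost_S)
qed

text \<open>A facility that is its own partner is not closed, as \<open>oc f\<close> already occurs
  on the right. Each other facility of \<open>opt_of f\<close> is covered by the inequality for
  adding it alone.\<close>

lemma charge_if_kept:
  assumes f: "f \<in> S" "f \<in> opt_of f"
  shows "oc f \<le> opening_cost oc (opt_of f) + (\<Sum>j\<in>C. charge f j)"
proof -
  let ?m = "\<lambda>j. min 0 (dst j (\<sigma>opt j) - dst j (\<sigma> j))"
  have fin: "finite (opt_of f)"
    using finite_subset[OF opt_of_subset finite_OPT] .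
  have ge: "(if \<sigma>opt j \<in> opt_of f then ?m j else 0) \<le> charge f j" if j: "j \<in> C" for j
  proof -
    have "?m j \<le> open_charge j"
      using dst_nonneg[of j "\<sigma>opt j"] by (auto simp: open_charge_def)
    then show ?thesis
      using close_charge_nonneg[OF j] \<sigma>opt[OF j] by (auto simp: charge_def opt_of_def)
  qed
  have "0 \<le> (\<Sum>g\<in>opt_of f. (if g \<in> S then 0 else oc g) + sum ?m (cluster C \<sigma>opt g))"
    using addition_bound opt_of_subset by (intro sum_nonneg) blast
  also have "\<dots> \<le> (\<Sum>g\<in>opt_of f. (if g = f then 0 else oc g) + sum ?m (cluster C \<sigma>opt g))"
    using f(1) oc OPT_F opt_of_subset by (intro sum_mono) auto
  also have "\<dots> = opening_cost oc (opt_of f) - oc f + (\<Sum>g\<in>opt_of f. sum ?m (cluster C \<sigma>opt g))"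
    using fin f(2) by (simp add: sum.distrib opening_cost_def sum.remove[of "opt_of f" f])
  also have "(\<Sum>g\<in>opt_of f. sum ?m (cluster C \<sigma>opt g)) = sum ?m {j \<in> C. \<sigma>opt j \<in> opt_of f}"
  proof -
    have "cluster C \<sigma>opt g = {j \<in> {j \<in> C. \<sigma>opt j \<in> opt_of f}. \<sigma>opt j = g}" if "g \<in> opt_of f" for g
      using that by (auto simp: cluster_def)
    then show ?thesis
      using fin finC by (subst sum.group[symmetric, where T = "opt_of f" and g = \<sigma>opt]) auto
  qed
  also have "\<dots> = (\<Sum>j\<in>C. if \<sigma>opt j \<in> opt_of f then ?m j else 0)"
    using finC by (simp add: sum.inter_filter)
  also have "\<dots> \<le> (\<Sum>j\<in>C. charge f j)"
    by (intro sum_mono ge)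
  finally show ?thesis by simp
qed

text \<open>\<open>f\<close> is replaced by \<open>opt_of f\<close>. If these already lie in
  \<open>S\<close>, dropping \<open>f\<close> is enough; otherwise one of them is swapped in and
  Extend-JMS prices the rest.\<close>

lemma charge_if_closed:
  assumes f: "f \<in> S" "f \<notin> opt_of f"
  shows "oc f \<le> opening_cost oc (opt_of f) + (\<Sum>j\<in>C. charge f j)"
proof -
  let ?T = "opt_of f"
  let ?g = "\<lambda>j. dst j (\<sigma> j) + charge f j"
  have finT: "finite ?T" and TF: "?T \<subseteq> F"
    using finite_subset[OF opt_of_subset finite_OPT] opt_of_subset OPT_F by auto
  have far: "2 * dst j (\<sigma>opt j) \<le> ?g j" if "j \<in> C" "\<sigma>opt j \<in> ?T - M" for j
    using that close_charge_nonneg[of j] by (auto simp: charge_def open_charge_def opt_of_def)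
  \<comment> \<open>Here \<open>X\<close> is the set opened outright; leaving it general serves both
    moves.\<close>
  have near: "\<exists>h\<in>X. dst j h \<le> ?g j"
    if j: "j \<in> C" and nT: "\<sigma>opt j \<notin> ?T - X" and X: "S - {f} \<subseteq> X" for j X
  proof (cases "partner (\<sigma>opt j) = f")
    case True
    then have oX: "\<sigma>opt j \<in> X"
      using nT \<sigma>opt[OF j] by (auto simp: opt_of_def)
    show ?thesis
    proof (cases "\<sigma>opt j \<in> M \<and> \<sigma> j \<noteq> f")
      case True
      then have "?g j = dst j (\<sigma> j)"
        using \<open>partner (\<sigma>opt j) = f\<close> by (auto simp: charge_def open_charge_def)
      moreover have "\<sigma> j \<in> X"
        using True X \<sigma>(1)[OF j] by auto
      ultimately show ?thesis by auto
    next
      case False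
      then have "dst j (\<sigma>opt j) \<le> ?g j"
        using \<open>partner (\<sigma>opt j) = f\<close> close_charge_nonneg[OF j] dst_nonneg[of j "\<sigma>opt j"]
        by (auto simp: charge_def open_charge_def)
      then show ?thesis using oX by blast
    qed
  next
    case False
    show ?thesis
    proof (cases "\<sigma> j = f")
      case True
      have pX: "partner (\<sigma>opt j) \<in> X"
        using False X partner_in_S by blast
      have "dst (\<sigma>opt j) (partner (\<sigma>opt j)) \<le> dst j (\<sigma>opt j) + dst j (\<sigma> j)" if "\<sigma>opt j \<notin> M"
      proof -
        have "dst (\<sigma>opt j) (partner (\<sigma>opt j)) \<le> dst (\<sigma>opt j) (\<sigma> j)"
          using partner_nearest that \<sigma>(1)[OF j] by blast
        also have "\<dots> \<le> dst (\<sigma>opt j) j + dst j (\<sigma> j)"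
          using dst_triangle j \<sigma>(1) \<sigma>opt OPT_F SF by blast
        finally show ?thesis
          by (simp add: dst_commute)
      qed
      then have "dst j (partner (\<sigma>opt j)) \<le> ?g j"
        using dst_partner_le[OF j] True False by (auto simp: charge_def close_charge_def)
      then show ?thesis using pX by blast
    next
      case ne: False
      then have "?g j = dst j (\<sigma> j)"
        using False by (simp add: charge_def)
      moreover have "\<sigma> j \<in> X"
        using ne X \<sigma>(1)[OF j] by auto
      ultimately show ?thesis by auto
    qed
  qed
  have "\<exists>X. X \<union> (?T - X) = S - {f} \<union> ?T \<and> X \<subseteq> F \<and>
          cost C dst oc S \<le> opening_cost oc X + opening_cost oc (?T - X) + sum ?g C"
  proof (cases "?T \<subseteq> S")
    case True
    let ?X = "S - {f}"
    have TX: "?T - ?X = {}"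
      using True f by auto
    \<comment> \<open>If \<open>f\<close> were all of \<open>S\<close>, it would be the partner of
      every optimal facility, so \<open>opt_of f\<close> would be the nonempty \<open>OPT\<close>,
      yet it lies in the empty \<open>?X\<close>.\<close>
    have "?X \<noteq> {}"
    proof
      assume e: "?X = {}"
      then have "?T = {}" using TX by auto
      moreover have "partner g = f" for g
        using partner_in_S[of g] e by auto
      ultimately show False
        using OPT by (auto simp: opt_of_def feasible_def)
    qed
    then have "feasible F ?X"
      using SF by (auto simp: feasible_def)
    moreover have "?X - S = {}" "S - ?X = {f}"
      using f by auto
    then have "card (?X - S) + card (S - ?X) \<le> 1"
      by (simp only:) simp
    ultimately have "cost C dst oc S \<le> cost C dst oc ?X"
      by (rule cost_le_if_symdiff_le_1)
    also have "conn_cost C dst ?X \<le> sum ?g C"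
      using near[of _ ?X] TX finite_S by (intro conn_cost_le) auto
    then have "cost C dst oc ?X \<le> opening_cost oc ?X + sum ?g C"
      by (simp add: cost_def)
    finally have "cost C dst oc S \<le> opening_cost oc ?X + opening_cost oc (?T - ?X) + sum ?g C"
      unfolding TX by (simp add: opening_cost_def)
    then show ?thesis
      using SF by (intro exI[of _ ?X]) auto
  next
    case False
    \<comment> \<open>A matched facility outside \<open>S\<close> is preferred for the swap: what
      remains for Extend-JMS is then lonely, and its clients can pay twice their distance.\<close>
    obtain f2 where f2: "f2 \<in> ?T - S" and f2M: "\<And>h. h \<in> ?T - S \<Longrightarrow> h \<in> M \<Longrightarrow> f2 \<in> M"
      using False by (cases "(?T - S) \<inter> M = {}") auto
    let ?X = "S - {f} \<union> {f2}"
    have XF: "?X \<subseteq> F"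
      using SF f2 TF by auto
    have TX: "?T - ?X \<subseteq> ?T - M"
    proof
      fix h assume h: "h \<in> ?T - ?X"
      have "h \<notin> M"
      proof
        assume hM: "h \<in> M"
        moreover have "h \<in> ?T - S"
          using h f(2) by auto
        ultimately have "f2 \<in> M"
          using f2M by blast
        then have "h = f2"
          using partner_inj_on_matched[OF hM] h f2 by (auto simp: opt_of_def)
        then show False
          using h by auto
      qed
      then show "h \<in> ?T - M" using h by auto
    qed
    have nearX: "\<exists>h\<in>?X. dst j h \<le> ?g j" if "j \<in> C" "\<sigma>opt j \<notin> ?T - ?X" for j
      using near[OF that] by auto
    have farX: "2 * dst j (\<sigma>opt j) \<le> ?g j" if "j \<in> C" "\<sigma>opt j \<in> ?T - ?X" for j
      using far that TX by blast
    have TXF: "?T - ?X \<subseteq> F" using TF by auto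
    note ext = extend_jms_bound[where \<sigma> = \<sigma>opt and g = ?g, OF oc impl C XF TXF nearX farX]
    have "f2 \<in> F - S"
      using f2 TF by blast
    then have "cost C dst oc S \<le> opening_cost oc ?X + opening_cost oc (?T - ?X) + sum ?g C"
      using order_trans[OF cost_le_extend_jms[OF f(1) _ ext(1)] ext(2)] by blast
    then show ?thesis
      using XF f2 by (intro exI[of _ ?X]) auto
  qed
  then obtain X where X: "X \<union> (?T - X) = S - {f} \<union> ?T" "X \<subseteq> F"
    and le: "cost C dst oc S \<le> opening_cost oc X + opening_cost oc (?T - X) + sum ?g C"
    by blast
  have "opening_cost oc X + opening_cost oc (?T - X) = opening_cost oc (S - {f} \<union> ?T)"
    unfolding X(1)[symmetric] opening_cost_def
    using finT finite_subset[OF X(2) finF] by (intro sum.union_disjoint[symmetric]) auto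
  \<comment> \<open>Facilities in both sets are counted twice on the right, harmless since costs are
    nonnegative.\<close>
  also have "\<dots> \<le> opening_cost oc (S - {f}) + opening_cost oc ?T"
    unfolding opening_cost_def using finT finite_S SF TF oc
    by (subst sum_Un) (auto intro!: sum_nonneg)
  also have "opening_cost oc (S - {f}) = opening_cost oc S - oc f"
    using finite_S f(1) by (simp add: opening_cost_def sum_diff1)
  finally show ?thesis
    using le by (simp add: cost_S sum.distrib)
qed

section \<open>Summation of the charges\<close>

lemma total_charge_bound:
  "opening_cost oc S \<le> opening_cost oc OPT + (\<Sum>j\<in>C. open_charge j + close_charge j)"
proof -
  have "opening_cost oc S \<le> (\<Sum>f\<in>S. opening_cost oc (opt_of f) + (\<Sum>j\<in>C. charge f j))"
    unfolding opening_cost_def[of oc S]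
    using charge_if_kept charge_if_closed by (intro sum_mono) blast
  also have "\<dots> = (\<Sum>f\<in>S. opening_cost oc (opt_of f)) + (\<Sum>j\<in>C. \<Sum>f\<in>S. charge f j)"
    using sum.swap[of charge C S] by (simp add: sum.distrib)
  \<comment> \<open>Partners partition \<open>OPT\<close>, so each of its opening costs is counted
    once.\<close>
  also have "(\<Sum>f\<in>S. opening_cost oc (opt_of f)) = opening_cost oc OPT"
    unfolding opening_cost_def opt_of_def
    using partner_in_S by (intro sum.group finite_S finite_OPT) auto
  also have "(\<Sum>j\<in>C. \<Sum>f\<in>S. charge f j) = (\<Sum>j\<in>C. open_charge j + close_charge j)"
  proof (rule sum.cong)
    fix j assume "j \<in> C"
    then show "(\<Sum>f\<in>S. charge f j) = open_charge j + close_charge j"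
      using \<sigma>(1) partner_in_S finite_S by (simp add: charge_def sum.distrib)
  qed simp
  finally show ?thesis .
qed

text \<open>Fewer than a \<open>\<delta>\<close>-fraction of the clients of a matched \<open>f\<close> are rerouted over the distance
  from \<open>f\<close> to its partner, and each of the others pays for it with its two connections.\<close>

lemma matched_cluster_charge:
  assumes f: "f \<in> M"
  shows "(\<Sum>j\<in>cluster C \<sigma>opt f. open_charge j + close_charge j)
    \<le> (\<Sum>j\<in>cluster C \<sigma>opt f. 1 / (1 - \<delta>) * dst j (\<sigma>opt j) + (\<delta> / (1 - \<delta>) - 1) * dst j (\<sigma> j))"
proof -
  let ?N = "cluster C \<sigma>opt f"
  let ?I = "cluster C \<sigma> (partner f) \<inter> ?N"
  let ?w = "\<lambda>j. dst j (\<sigma>opt j) + dst j (\<sigma> j)"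
  define D where "D = dst f (partner f)"
  \<comment> \<open>\<open>r\<close> bounds the number of uncaptured clients of \<open>f\<close> per
    captured one.\<close>
  define r where "r = \<delta> / (1 - \<delta>)"
  have r: "0 \<le> r" "1 / (1 - \<delta>) = 1 + r"
    using \<delta> by (auto simp: r_def field_simps)
  have fin: "finite ?N"
    using finC by (simp add: cluster_def)
  have fF: "f \<in> F" "partner f \<in> F"
    using f OPT_F partner_in_S SF by (auto simp: matched_opt_def)
  have card: "card ?N = card ?I + card (?N - ?I)"
    using fin by (simp add: card_Diff_subset card_mono)
  have "real (card ?I) > (1 - \<delta>) * real (card ?N)"
    using partner_matched[OF f] by (auto simp: matched_def captures_def)
  then have "(1 - \<delta>) * real (card (?N - ?I)) \<le> \<delta> * real (card ?I)"
    unfolding card by (simp add: algebra_simps)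
  then have few: "real (card (?N - ?I)) \<le> r * real (card ?I)"
    using \<delta> by (simp add: r_def field_simps)
  have "(\<Sum>j\<in>?I. D) \<le> sum ?w ?I"
  proof (rule sum_mono)
    fix j assume "j \<in> ?I"
    then have j: "j \<in> C" "\<sigma>opt j = f" "\<sigma> j = partner f"
      by (auto simp: cluster_def)
    then show "D \<le> ?w j"
      using dst_triangle[of f j "partner f"] fF dst_commute[of f j] by (simp add: D_def)
  qed
  then have avg: "real (card ?I) * D \<le> sum ?w ?I"
    by simp
  have D: "0 \<le> D"
    by (simp add: D_def dst_nonneg)
  \<comment> \<open>Captured clients pay at opening, the others at closing, and only the latter
    carry the detour \<open>D\<close>.\<close>
  have "(\<Sum>j\<in>?N. open_charge j + close_charge j)
      = (\<Sum>j\<in>?N. dst j (\<sigma>opt j) - dst j (\<sigma> j) + (if j \<in> ?N - ?I then D else 0))"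
    using f by (intro sum.cong) (auto simp: cluster_def open_charge_def close_charge_def D_def)
  also have "\<dots> = (\<Sum>j\<in>?N. dst j (\<sigma>opt j) - dst j (\<sigma> j)) + real (card (?N - ?I)) * D"
  proof -
    have "?N \<inter> {j. j \<in> ?N - ?I} = ?N - ?I"
      by blast
    then show ?thesis
      using fin by (simp only: sum.distrib sum.If_cases) simp
  qed
  also have "real (card (?N - ?I)) * D \<le> (r * real (card ?I)) * D"
    using few D by (rule mult_right_mono)
  also have "\<dots> \<le> r * sum ?w ?I"
    using mult_left_mono[OF avg r(1)] by (simp add: mult.assoc)
  also have "\<dots> \<le> r * sum ?w ?N"
    using fin r(1) by (intro mult_left_mono sum_mono2) (auto simp: dst_nonneg add_nonneg_nonneg)
  also have "(\<Sum>j\<in>?N. dst j (\<sigma>opt j) - dst j (\<sigma> j)) + r * sum ?w ?N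
      = (\<Sum>j\<in>?N. (1 + r) * dst j (\<sigma>opt j) + (r - 1) * dst j (\<sigma> j))"
    by (simp add: sum_distrib_left sum.distrib[symmetric] algebra_simps)
  finally show ?thesis
    using r(2) by (simp add: r_def)
qed

lemma local_optimum_bound:
  "opening_cost oc S + conn_cost C dst S \<le>
     opening_cost oc OPT
     + \<delta> / (1 - \<delta>) * conn_cost C dst S
     + 1 / (1 - \<delta>) * conn_cost_served_by C dst \<sigma>opt M
     + 4 * conn_cost_served_by C dst \<sigma>opt (lonely_opt C \<delta> S \<sigma> OPT \<sigma>opt)"
proof -
  let ?c = "\<lambda>j. open_charge j + close_charge j"
  let ?A = "{j \<in> C. \<sigma>opt j \<in> M}"
  let ?L = "{j \<in> C. \<sigma>opt j \<in> OPT - M}"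
  let ?opt = "\<lambda>j. dst j (\<sigma>opt j)" and ?d = "\<lambda>j. dst j (\<sigma> j)"
  define r where "r = \<delta> / (1 - \<delta>)"
  have r: "0 \<le> r"
    using \<delta> by (simp add: r_def)
  have split: "sum h C = sum h ?A + sum h ?L" for h :: "'a \<Rightarrow> real"
  proof -
    have "C = ?A \<union> ?L" "?A \<inter> ?L = {}"
      using \<sigma>opt by auto
    then show ?thesis
      using finC sum.union_disjoint[of ?A ?L h] by auto
  qed
  have finM: "finite M"
    using finite_OPT by (simp add: matched_opt_def)
  have cl: "{j \<in> ?A. \<sigma>opt j = f} = cluster C \<sigma>opt f" if "f \<in> M" for f
    using that by (auto simp: cluster_def)
  have group: "sum h ?A = (\<Sum>f\<in>M. sum h (cluster C \<sigma>opt f))" for h :: "'a \<Rightarrow> real"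
  proof -
    have "sum h ?A = (\<Sum>f\<in>M. sum h {j \<in> ?A. \<sigma>opt j = f})"
      using finC finM by (intro sum.group[symmetric]) auto
    also have "\<dots> = (\<Sum>f\<in>M. sum h (cluster C \<sigma>opt f))"
      using cl by (intro sum.cong) auto
    finally show ?thesis .
  qed
  have "sum ?c ?A \<le> (\<Sum>j\<in>?A. 1 / (1 - \<delta>) * ?opt j + (r - 1) * ?d j)"
    unfolding group r_def by (intro sum_mono matched_cluster_charge)
  also have "\<dots> = 1 / (1 - \<delta>) * sum ?opt ?A + (r - 1) * sum ?d ?A"
    by (simp add: sum.distrib sum_distrib_left)
  finally have A: "sum ?c ?A \<le> 1 / (1 - \<delta>) * sum ?opt ?A + r * sum ?d ?A - sum ?d ?A"
    by (simp add: algebra_simps)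
  have "sum ?c ?L = (\<Sum>j\<in>?L. 4 * ?opt j - ?d j)"
    by (intro sum.cong) (auto simp: open_charge_def close_charge_def)
  then have L: "sum ?c ?L = 4 * sum ?opt ?L - sum ?d ?L"
    by (simp add: sum_subtractf sum_distrib_left)
  \<comment> \<open>The negative distance terms of both classes add up to the connection cost on the
    left; the term with \<open>r\<close> is enlarged from matched clients to all.\<close>
  have "sum ?d ?A \<le> sum ?d C"
    using finC dst_nonneg by (intro sum_mono2) auto
  then have "r * sum ?d ?A \<le> r * sum ?d C"
    using r by (rule mult_left_mono)
  then show ?thesis
    using total_charge_bound A L split[of ?c] split[of ?d] conn_cost_serves[OF serves finite_S]
    by (simp add: conn_cost_served_by_def lonely_opt_def r_def)
qed

end

theorem theoremG3:
  "\<exists>K::real. \<forall>(C :: 'a set) F dst oc jms \<delta> \<epsilon> S' OPT \<sigma>' \<sigma>opt.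
     ufl_instance C F dst oc \<longrightarrow> implements_jms C F dst jms \<longrightarrow>
     0 < \<delta> \<longrightarrow> \<delta> \<le> 1/2 \<longrightarrow> 0 < \<epsilon> \<longrightarrow>
     local_search_jms C F dst oc jms \<epsilon> S' \<longrightarrow> feasible F OPT \<longrightarrow>
     serves C dst S' \<sigma>' \<longrightarrow> serves C dst OPT \<sigma>opt \<longrightarrow>
     opening_cost oc S' + conn_cost C dst S' \<le>
       opening_cost oc OPT
       + \<delta> / (1 - \<delta>) * conn_cost C dst S'
       + 1 / (1 - \<delta>) * conn_cost_served_by C dst \<sigma>opt (matched_opt C \<delta> S' \<sigma>' OPT \<sigma>opt)
       + 4 * conn_cost_served_by C dst \<sigma>opt (lonely_opt C \<delta> S' \<sigma>' OPT \<sigma>opt)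
       + K * (\<epsilon> * (conn_cost C dst S' + conn_cost C dst OPT))"
proof (intro exI[of _ 0] allI impI)
  fix C F :: "'a set" and dst oc jms \<delta> \<epsilon> S' OPT \<sigma>' \<sigma>opt
  assume inst: "ufl_instance C F dst oc" and impl: "implements_jms C F dst jms"
    and \<delta>: "0 < (\<delta>::real)" "\<delta> \<le> 1/2" and \<epsilon>: "0 < (\<epsilon>::real)"
    and ls: "local_search_jms C F dst oc jms \<epsilon> S'" and OPT: "feasible F OPT"
    and sv: "serves C dst S' \<sigma>'" "serves C dst OPT \<sigma>opt"
  have oc: "\<forall>f\<in>F. 0 \<le> oc f"
    using inst by (simp add: ufl_instance_def)
  interpret ufl_metric C F dst
    using inst by (simp add: ufl_metric_def ufl_instance_def)
  have out: "jms_output C F dst oc (jms oc)"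
    using impl oc by (simp add: implements_jms_def)
  obtain \<alpha> where start: "jms oc \<subseteq> F" "cost C dst oc (jms oc) \<le> sum \<alpha> C"
    using jms_output_dual[OF out oc] by metis
  have run: "(ls_improves C F dst oc jms \<epsilon>)\<^sup>*\<^sup>* (jms oc) S'"
    and stop: "\<not> ls_improves C F dst oc jms \<epsilon> S' S2" for S2
    using ls by (auto simp: local_search_jms_def)
  have S': "S' \<subseteq> F \<and> cost C dst oc S' \<le> cost C dst oc (jms oc)"
    using run by induction (auto simp: start ls_improves_def feasible_def)
  have "opening_cost oc S' + conn_cost C dst S' \<le>
       opening_cost oc OPT
       + \<delta> / (1 - \<delta>) * conn_cost C dst S'
       + 1 / (1 - \<delta>) * conn_cost_served_by C dst \<sigma>opt (matched_opt C \<delta> S' \<sigma>' OPT \<sigma>opt)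
       + 4 * conn_cost_served_by C dst \<sigma>opt (lonely_opt C \<delta> S' \<sigma>' OPT \<sigma>opt)"
  proof (cases "C = {}")
    case True
    \<comment> \<open>Without clients the cost of JMS is at most an empty sum of budgets, and local
      search never raises it.\<close>
    then have "cost C dst oc S' \<le> 0"
      using S' start(2) by simp
    moreover have "0 \<le> opening_cost oc OPT"
      using oc OPT by (auto simp: opening_cost_def feasible_def intro!: sum_nonneg)
    ultimately show ?thesis
      using True by (simp add: cost_def conn_cost_def conn_cost_served_by_def)
  next
    case False
    interpret jms_local_optimum C F dst oc jms \<delta> \<epsilon> S' OPT \<sigma>' \<sigma>opt
      using oc impl False \<delta> \<epsilon> stop S' OPT sv by unfold_locales auto
    show ?thesis
      by (rule local_optimum_bound)
  qed
  then show "opening_cost oc S' + conn_cost C dst S' \<le>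
       opening_cost oc OPT
       + \<delta> / (1 - \<delta>) * conn_cost C dst S'
       + 1 / (1 - \<delta>) * conn_cost_served_by C dst \<sigma>opt (matched_opt C \<delta> S' \<sigma>' OPT \<sigma>opt)
       + 4 * conn_cost_served_by C dst \<sigma>opt (lonely_opt C \<delta> S' \<sigma>' OPT \<sigma>opt)
       + 0 * (\<epsilon> * (conn_cost C dst S' + conn_cost C dst OPT))"
    by simp
qed

end
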